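(* Let $\nu$ cars move on a ring road with car density $d>0$, let $\bar y = 1/d$, and let $M^{juw}$, $c^{juw}$ be the matrices and vectors of the multi-anticipative ring-road model with $m$ leaders described in the context. If $\alpha_{juw}\in[0,1]$ for all $(j,u,w)\in\{1,2,\ldots,m\}\times U\times W$, then the system $$\bar v + x_n = \min_{1\le j\le m}\ \min_{u\in U}\ \max_{w\in W}\ \left\{[M^{juw}x]_n + c_n^{juw}\right\},\qquad 1\le n\le \nu,$$ in the unknowns $\bar v\in\mathbb{R}$ and $x\in\mathbb{R}^\nu$, admits a solution $(\bar v,x)$ given by $$\bar v=\min_{u\in U}\max_{w\in W}\{\alpha_{1uw}\bar y+\beta_{1uw}\},\qquad x={}^t\big((\nu-1)\bar y,(\nu-2)\bar y,\ldots,\bar y,0\big).$$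
   Context: $U$ and $W$ are finite nonempty index sets and $m\ge 1$ is the number of leaders (cars ahead) taken into account, with $m<\nu$. For every $(u,w)\in U\times W$, $(\alpha_{juw})_{1\le j\le m}$ is a non-decreasing (in $j$) sequence of non-negative reals and $(\beta_{juw})_{1\le j\le m}$ is a non-decreasing (in $j$) sequence of reals. The $\nu$ cars, numbered $1,\ldots,\nu$ with car $n-1$ directly ahead of car $n$, move on a ring road of length $\nu/d$ without passing, with positions evolving by $$x_n(t+1)=x_n(t)+\min_{1\le j\le m}\min_{u\in U}\max_{w\in W}\left\{\alpha_{juw}\frac{x_{n-j}(t)-x_n(t)}{j}+\beta_{juw}\right\},$$ where the indices $n-j$ are cyclic in $\{1,\ldots,\nu\}$ and the road length $\nu/d$ is added to $x_{n-j}$ whenever the index wraps around. Equivalently, $x_n(t+1)=\min_{j}\min_{u}\max_{w}\{[M^{juw}x(t)]_n+c^{juw}_n\}$, where for $1\le n\le\nu$ $$[M^{juw}x]_n=\Big(1-\frac{\alpha_{juw}}{j}\Big)x_n+\frac{\alpha_{juw}}{j}\,x_{\sigma_j(n)},$$ with $\sigma_j(n)\in\{1,\ldots,\nu\}$ and $\sigma_j(n)\equiv n-j \pmod \nu$, and $$c^{juw}_n=\begin{cases}\dfrac{\alpha_{juw}}{j}\cdot\dfrac{\nu}{d}+\beta_{juw}, & 1\le n\le j,\\[2mm] \beta_{juw}, & j<n\le \nu.\end{cases}$$ *)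

theory Defs
  imports Complex_Main "HOL-Number_Theory.Cong"
begin

(* Vectors of R^\<nu> are functions nat \<Rightarrow> real of which only the entries 1, ..., \<nu> are used. *)

definition leader :: "nat \<Rightarrow> nat \<Rightarrow> nat \<Rightarrow> nat" where
  "leader \<nu> j n = (THE k. k \<in> {1..\<nu>} \<and> [int k = int n - int j] (mod int \<nu>))"

(* The linear map x \<mapsto> M x for one triple (j, u, w), where a = \<alpha> j u w. *)
definition car_matrix :: "nat \<Rightarrow> nat \<Rightarrow> real \<Rightarrow> (nat \<Rightarrow> real) \<Rightarrow> nat \<Rightarrow> real" where
  "car_matrix \<nu> j a x n = (1 - a / real j) * x n + a / real j * x (leader \<nu> j n)"

(* The vector c for one triple (j, u, w), where a = \<alpha> j u w and b = \<beta> j u w.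
   The road length \<nu> / d enters for the cars whose j-th leader is found by wrapping around. *)
definition car_vector :: "nat \<Rightarrow> real \<Rightarrow> nat \<Rightarrow> real \<Rightarrow> real \<Rightarrow> nat \<Rightarrow> real" where
  "car_vector \<nu> d j a b n = (if n \<le> j then a / real j * (real \<nu> / d) + b else b)"

definition car_system_solution ::
  "nat \<Rightarrow> real \<Rightarrow> nat \<Rightarrow> 'u set \<Rightarrow> 'w set \<Rightarrow> (nat \<Rightarrow> 'u \<Rightarrow> 'w \<Rightarrow> real) \<Rightarrow>
    (nat \<Rightarrow> 'u \<Rightarrow> 'w \<Rightarrow> real) \<Rightarrow> real \<Rightarrow> (nat \<Rightarrow> real) \<Rightarrow> bool" where
  "car_system_solution \<nu> d m U W \<alpha> \<beta> v x \<longleftrightarrow>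
    (\<forall>n\<in>{1..\<nu>}. v + x n =
      (MIN j\<in>{1..m}. MIN u\<in>U. MAX w\<in>W.
        car_matrix \<nu> j (\<alpha> j u w) x n + car_vector \<nu> d j (\<alpha> j u w) (\<beta> j u w) n))"

lemma leader_eq:
  assumes "n \<in> {1..\<nu>}" "j < \<nu>"
  shows "leader \<nu> j n = (if j < n then n - j else n + \<nu> - j)" (is "_ = ?k'")
  unfolding leader_def
proof (rule the_equality)
  have "int ?k' = int n - int j \<or> int ?k' = (int n - int j) + int \<nu>"
    using assms by (simp add: of_nat_diff)
  then have cong: "[int ?k' = int n - int j] (mod int \<nu>)"
    unfolding cong_def by (elim disjE) (simp_all only: mod_add_self2)
  have range: "?k' \<in> {1..\<nu>}"
    using assms by simp linarith
  from range cong show "?k' \<in> {1..\<nu>} \<and> [int ?k' = int n - int j] (mod int \<nu>)"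
    by (rule conjI)
  fix k assume k: "k \<in> {1..\<nu>} \<and> [int k = int n - int j] (mod int \<nu>)"
  with cong have "[int k = int ?k'] (mod int \<nu>)"
    using cong_sym cong_trans by blast
  then have "int \<nu> dvd int k - int ?k'"
    by (rule cong_iff_dvd_diff[THEN iffD1])
  moreover have "\<bar>int k - int ?k'\<bar> < int \<nu>"
    using k range unfolding atLeastAtMost_iff by linarith
  ultimately have "int k - int ?k' = 0"
    using dvd_imp_le_int[of "int k - int ?k'" "int \<nu>"] by linarith
  then show "k = ?k'" by linarith
qed

end

theory Submission
  imports Defs
begin

text \<open>
  In the proposed configuration consecutive cars are \<open>ybar\<close> apart all around the ring, so the
  \<open>j\<close>-th leader of any car is exactly \<open>j * ybar\<close> ahead of it. This distance,
  averaged over the \<open>j\<close> gaps that it spans, is \<open>ybar\<close> for every \<open>j\<close> and every car, so the term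
  for \<open>(j, u, w)\<close> at car \<open>n\<close> is \<open>\<alpha> j u w * ybar + \<beta> j u w + x n\<close>
  (lemma \<open>car_map_equal_spacing\<close>). The summand \<open>x n\<close> comes out of the minima and the maximum,
  which leaves a speed that does not depend on \<open>n\<close>. Since \<open>ybar > 0\<close> and \<open>\<alpha>\<close> and \<open>\<beta>\<close> are
  non-decreasing in \<open>j\<close>, this speed is smallest for \<open>j = 1\<close> (by lemma \<open>Min_Max_mono\<close>): only the nearest
  leader determines the speed.
\<close>

text \<open>
  Going back around the ring from car \<open>n\<close> to its \<open>j\<close>-th leader, either the index drops by \<open>j\<close> and
  the position grows by \<open>j * ybar\<close>, or the index wraps around to \<open>n + \<nu> - j\<close>; then the position
  falls short by \<open>\<nu> * ybar\<close>, which is the road length that the vector adds for these cars.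
\<close>
lemma car_map_equal_spacing:
  fixes a b d ybar :: real
  assumes "n \<in> {1..\<nu>}" "1 \<le> j" "j < \<nu>" "ybar = 1 / d"
  defines "x \<equiv> \<lambda>k. (real \<nu> - real k) * ybar"
  shows "car_matrix \<nu> j a x n + car_vector \<nu> d j a b n = a * ybar + b + x n"
proof (cases "j < n")
  case True
  have "x (leader \<nu> j n) = x n + real j * ybar"
    using assms(1,3) True by (simp add: leader_eq x_def of_nat_diff algebra_simps)
  then show ?thesis
    using True assms(2) by (simp add: car_matrix_def car_vector_def field_simps)
next
  case False
  have "x (leader \<nu> j n) = x n + real j * ybar - real \<nu> * ybar"
    using assms(1,3) False by (simp add: leader_eq x_def of_nat_diff algebra_simps)
  moreover have "real \<nu> / d = real \<nu> * ybar"
    using assms(4) by simp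
  ultimately have "car_matrix \<nu> j a x n + car_vector \<nu> d j a b n =
      (1 - a / real j) * x n + a / real j * (x n + real j * ybar - real \<nu> * ybar)
        + (a / real j * (real \<nu> * ybar) + b)"
    using False by (simp add: car_matrix_def car_vector_def)
  also have "\<dots> = a * ybar + b + x n"
    using assms(2) by (simp add: field_simps)
  finally show ?thesis .
qed

lemma Min_Max_add_right:
  fixes f :: "'u \<Rightarrow> 'w \<Rightarrow> 'a::linordered_ab_group_add"
  assumes "finite U" "U \<noteq> {}" "finite W" "W \<noteq> {}"
  shows "(MIN u\<in>U. MAX w\<in>W. f u w + k) = (MIN u\<in>U. MAX w\<in>W. f u w) + k"
  using assms by (simp add: Max_add_commute Min_add_commute)

lemma Min_Max_mono:
  fixes f g :: "'u \<Rightarrow> 'w \<Rightarrow> 'a::linorder"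
  assumes "finite U" "U \<noteq> {}" "finite W" "W \<noteq> {}"
    and le: "\<And>u w. u \<in> U \<Longrightarrow> w \<in> W \<Longrightarrow> f u w \<le> g u w"
  shows "(MIN u\<in>U. MAX w\<in>W. f u w) \<le> (MIN u\<in>U. MAX w\<in>W. g u w)"
proof -
  have max_le: "(MAX w\<in>W. f u w) \<le> (MAX w\<in>W. g u w)" if "u \<in> U" for u
    using assms(3,4) le[OF that] by (subst Max_le_iff) (auto simp: Max_ge_iff)
  have "(MIN u\<in>U. MAX w\<in>W. f u w) \<le> (MAX w\<in>W. g u w)" if "u \<in> U" for u
    using assms(1) that by (intro order_trans[OF Min_le max_le]) auto
  then show ?thesis
    using assms(1,2) by (subst Min_ge_iff) auto
qed

theorem theorem1:
  fixes \<nu> m :: nat and d ybar :: real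
    and U :: "'u set" and W :: "'w set"
    and \<alpha> \<beta> :: "nat \<Rightarrow> 'u \<Rightarrow> 'w \<Rightarrow> real"
  assumes "finite U" "U \<noteq> {}" "finite W" "W \<noteq> {}"
    and "1 \<le> m" "m < \<nu>"
    and "\<And>j u w. j \<in> {1..m} \<Longrightarrow> u \<in> U \<Longrightarrow> w \<in> W \<Longrightarrow> 0 \<le> \<alpha> j u w"
    and "\<And>u w. u \<in> U \<Longrightarrow> w \<in> W \<Longrightarrow> mono_on {1..m} (\<lambda>j. \<alpha> j u w)"
    and "\<And>u w. u \<in> U \<Longrightarrow> w \<in> W \<Longrightarrow> mono_on {1..m} (\<lambda>j. \<beta> j u w)"
    and "d > 0" "ybar = 1 / d"
    and "\<And>j u w. j \<in> {1..m} \<Longrightarrow> u \<in> U \<Longrightarrow> w \<in> W \<Longrightarrow> \<alpha> j u w \<in> {0..1}"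
  shows "car_system_solution \<nu> d m U W \<alpha> \<beta>
    (MIN u\<in>U. MAX w\<in>W. \<alpha> 1 u w * ybar + \<beta> 1 u w)
    (\<lambda>n. (real \<nu> - real n) * ybar)"
proof -
  define x where "x = (\<lambda>n. (real \<nu> - real n) * ybar)"
  define speed where "speed j = (MIN u\<in>U. MAX w\<in>W. \<alpha> j u w * ybar + \<beta> j u w)" for j
  have ybar: "0 \<le> ybar"
    using assms(10,11) by simp
  have nearest: "speed 1 \<le> speed j" if j: "j \<in> {1..m}" for j
    unfolding speed_def
  proof (rule Min_Max_mono[OF assms(1-4)])
    fix u w assume "u \<in> U" "w \<in> W"
    then have "\<alpha> 1 u w \<le> \<alpha> j u w" "\<beta> 1 u w \<le> \<beta> j u w"
      using j by (auto intro: mono_onD[OF assms(8)] mono_onD[OF assms(9)])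
    then show "\<alpha> 1 u w * ybar + \<beta> 1 u w \<le> \<alpha> j u w * ybar + \<beta> j u w"
      using ybar by (intro add_mono mult_right_mono)
  qed
  have "speed 1 + x n = (MIN j\<in>{1..m}. MIN u\<in>U. MAX w\<in>W.
      car_matrix \<nu> j (\<alpha> j u w) x n + car_vector \<nu> d j (\<alpha> j u w) (\<beta> j u w) n)"
    (is "_ = (MIN j\<in>_. ?F j)") if n: "n \<in> {1..\<nu>}" for n
  proof -
    have F: "?F j = speed j + x n" if "j \<in> {1..m}" for j
    proof -
      have "1 \<le> j" "j < \<nu>"
        using that assms(6) by auto
      then have "?F j = (MIN u\<in>U. MAX w\<in>W. \<alpha> j u w * ybar + \<beta> j u w + x n)"
        unfolding x_def by (simp only: car_map_equal_spacing[OF n _ _ assms(11)])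
      then show ?thesis
        by (simp only: Min_Max_add_right[OF assms(1-4)] speed_def)
    qed
    have "(MIN j\<in>{1..m}. ?F j) = speed 1 + x n"
    proof (rule Min_eqI)
      fix y assume "y \<in> ?F ` {1..m}"
      then show "speed 1 + x n \<le> y"
        using F nearest by auto
    next
      have "1 \<in> {1..m}"
        using assms(5) by simp
      then show "speed 1 + x n \<in> ?F ` {1..m}"
        using F by (metis (no_types, lifting) image_eqI)
    qed simp
    then show ?thesis ..
  qed
  then show ?thesis
    unfolding car_system_solution_def speed_def x_def by blast
qed

end
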